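(* Let $M\in\mathbb{R}^{(n+1)\times(n+1)}$ be a singular $F_0$-matrix, written in the form $$M=\begin{pmatrix} A & b\\ c^T & 0\end{pmatrix},$$ where $A\in\mathbb{R}^{n\times n}$ is an $N_0$-matrix and $b,c\in\mathbb{R}^n$ are (entrywise) nonpositive vectors. Then: (1) $\operatorname{rk}(M)=n$. (2) The group inverse $M^{\#}$ exists. (3) If $M$ is reducible, then $M^{\#}\le 0$ (so that $M^{\#}$ is a $Z$-matrix).
   Context: Inequalities between matrices or vectors are entrywise. A real square matrix is a $Z$-matrix if all its off-diagonal entries are nonpositive; any $Z$-matrix can be written as $A=sI-B$ with $s\in\mathbb{R}$ and $B\ge 0$. Let $\rho$ denote the spectral radius, and for $B\in\mathbb{R}^{m\times m}$ let $\rho_{m-1}(B)$ be the maximum of the spectral radii of the principal submatrices of $B$ of order $m-1$. A $Z$-matrix $A=sI-B$ ($B\ge0$) of order $m$ is an $M$-matrix if $s\ge\rho(B)$, and an $N_0$-matrix if $\rho_{m-1}(B)\le s<\rho(B)$. A $Z$-matrix of order $m\ge 3$ is an $F_0$-matrix if all its principal submatrices of orders at most $m-2$ are $M$-matrices and at least one principal submatrix of order $m-1$ is an $N_0$-matrix. (Every singular $F_0$-matrix of order $n+1$ can be brought to the displayed form by a simultaneous permutation of rows and columns.) The group inverse $M^{\#}$ of a square matrix $M$ is the unique matrix $X$, if it exists, with $MXM=M$, $XMX=X$, $MX=XM$. *)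

theory Defs
  imports
    "Jordan_Normal_Form.Spectral_Radius"
    "Jordan_Normal_Form.DL_Rank"
    "Jordan_Normal_Form.DL_Submatrix"
begin

definition rho :: "real mat \<Rightarrow> real" where
  "rho B = spectral_radius (map_mat complex_of_real B)"

(* Orders of principal submatrices are positive: the empty index set is excluded. *)
definition principal_submatrices :: "nat \<Rightarrow> 'a mat \<Rightarrow> 'a mat set" where
  "principal_submatrices k M =
     {submatrix M I I | I. I \<subseteq> {..<dim_row M} \<and> card I = k \<and> 0 < k}"

definition rho_sub :: "real mat \<Rightarrow> real" where
  "rho_sub B = Max (rho ` principal_submatrices (dim_row B - 1) B)"

definition Z_matrix :: "real mat \<Rightarrow> bool" where
  "Z_matrix A \<longleftrightarrow> square_mat A \<and>
     (\<forall>i<dim_row A. \<forall>j<dim_row A. i \<noteq> j \<longrightarrow> A $$ (i, j) \<le> 0)"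

definition nonneg_splitting :: "real mat \<Rightarrow> real \<Rightarrow> real mat \<Rightarrow> bool" where
  "nonneg_splitting A s B \<longleftrightarrow>
     (let m = dim_row A in B \<in> carrier_mat m m \<and> 0\<^sub>m m m \<le> B \<and> A = s \<cdot>\<^sub>m 1\<^sub>m m - B)"

(* The conditions in M_matrix and N0_matrix do not depend on the choice of splitting: any two
   splittings are related by (s, B) and (s + t, B + t I), and passing from B to B + t I with both
   nonnegative shifts rho and rho_sub by t. *)
definition M_matrix :: "real mat \<Rightarrow> bool" where
  "M_matrix A \<longleftrightarrow> Z_matrix A \<and> (\<exists>s B. nonneg_splitting A s B \<and> rho B \<le> s)"

(* Order 1 is left out: there are no proper principal submatrices, so rho_sub would be the
   maximum of the empty set. *)
definition N0_matrix :: "real mat \<Rightarrow> bool" where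
  "N0_matrix A \<longleftrightarrow> Z_matrix A \<and> 2 \<le> dim_row A \<and>
     (\<exists>s B. nonneg_splitting A s B \<and> rho_sub B \<le> s \<and> s < rho B)"

definition F0_matrix :: "real mat \<Rightarrow> bool" where
  "F0_matrix M \<longleftrightarrow> Z_matrix M \<and> 3 \<le> dim_row M \<and>
     (\<forall>k \<le> dim_row M - 2. \<forall>S \<in> principal_submatrices k M. M_matrix S) \<and>
     (\<exists>S \<in> principal_submatrices (dim_row M - 1) M. N0_matrix S)"

(* A simultaneous row and column permutation yields a block upper triangular matrix with
   nonempty square diagonal blocks. *)
definition reducible_mat :: "'a :: zero mat \<Rightarrow> bool" where
  "reducible_mat M \<longleftrightarrow>
     (\<exists>p k l P Q R. p permutes {..<dim_row M} \<and> 0 < k \<and> 0 < l \<and>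
        P \<in> carrier_mat k k \<and> Q \<in> carrier_mat k l \<and> R \<in> carrier_mat l l \<and>
        mat (dim_row M) (dim_col M) (\<lambda>(i, j). M $$ (p i, p j))
          = four_block_mat P Q (0\<^sub>m l k) R)"

definition is_group_inverse :: "'a :: semiring_0 mat \<Rightarrow> 'a mat \<Rightarrow> bool" where
  "is_group_inverse M X \<longleftrightarrow> X \<in> carrier_mat (dim_row M) (dim_row M) \<and>
     M * X * M = M \<and> X * M * X = X \<and> M * X = X * M"

lemma is_group_inverse_unique:
  fixes M :: "'a :: semiring_0 mat"
  assumes M: "square_mat M" and X: "is_group_inverse M X" and Y: "is_group_inverse M Y"
  shows "X = Y"
proof -
  define n where "n = dim_row M"
  have c [simp]: "M \<in> carrier_mat n n" "X \<in> carrier_mat n n" "Y \<in> carrier_mat n n"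
    using assms by (auto simp: is_group_inverse_def n_def)
  have x: "M * X * M = M" "X * M * X = X" "M * X = X * M"
    and y: "M * Y * M = M" "Y * M * Y = Y" "M * Y = Y * M"
    using X Y by (auto simp: is_group_inverse_def)
  have [simp]: "P * Q \<in> carrier_mat n n" if "P \<in> carrier_mat n n" "Q \<in> carrier_mat n n" for P Q :: "'a mat"
    using that by (rule mult_carrier_mat)
  note as = assoc_mult_mat[of _ n n _ n _ n]
  have "X * M = X * (M * Y * M)" using y by simp
  also have "\<dots> = (X * M) * (Y * M)" by (simp add: as)
  also have "\<dots> = (M * X) * (M * Y)" using x y by simp
  also have "\<dots> = (M * X * M) * Y" by (simp add: as)
  also have "\<dots> = M * Y" using x by simp
  finally have e: "X * M = M * Y" .
  have "X = X * M * X" using x by simp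
  also have "\<dots> = M * Y * X" using e by simp
  also have "\<dots> = Y * (M * X)" using y by (simp add: as)
  also have "\<dots> = Y * (M * Y)" using e x by simp
  also have "\<dots> = Y" using y by (simp add: as)
  finally show ?thesis .
qed

definition group_inverse :: "'a :: semiring_0 mat \<Rightarrow> 'a mat" where
  "group_inverse M = (THE X. is_group_inverse M X)"

lemma group_inverse_eq:
  "square_mat M \<Longrightarrow> is_group_inverse M X \<Longrightarrow> group_inverse M = X"
  unfolding group_inverse_def by (blast intro: is_group_inverse_unique the_equality)

end

theory Submission
  imports Defs "Jordan_Normal_Form.DL_Rank_Submatrix"
begin

text \<open>
  Write \<open>A = s I - B\<close> for the \<open>N\<^sub>0\<close>-block. The moduli of an eigenvector for an eigenvalue of
  maximal modulus form a vector \<open>u \<ge> 0\<close> with \<open>A u \<le> - e u\<close>, \<open>e > 0\<close>. Conversely a nonnegative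
  vector satisfying such an inequality and having a zero entry must vanish: otherwise it would push
  the spectral radius of a principal submatrix of order \<open>n - 1\<close> above \<open>s\<close>. Hence \<open>u > 0\<close>, and \<open>A\<close> is
  irreducible (cut \<open>u\<close> off to an index set). If \<open>A x \<ge> 0\<close> and \<open>x\<close> had a positive entry, then
  \<open>u - a x\<close>, with \<open>a\<close> the largest scalar keeping it nonnegative, would be another such vector; so
  \<open>A x \<ge> 0\<close> implies \<open>x \<le> 0\<close>, which gives invertibility and \<open>L = A\<^sup>-\<^sup>1 \<le> 0\<close> at once.

  With \<open>X = L b \<ge> 0\<close> and \<open>Y = c\<^sup>T L \<ge> 0\<close> singularity means \<open>Y A X = 0\<close>, so \<open>M = F A G\<close> where \<open>F\<close>
  is \<open>I\<close> stacked on \<open>Y\<close> and \<open>G = (I, X)\<close>. Here \<open>G F = I + X Y\<close> is invertible because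
  \<open>Y X \<ge> 0\<close>, and \<open>F (G F)\<^sup>-\<^sup>1 L (G F)\<^sup>-\<^sup>1 G\<close> is the group inverse. If \<open>M\<close> is reducible, irreducibility of
  \<open>A\<close> forces \<open>b = 0\<close> or \<open>c = 0\<close>, and the group inverse becomes \<open>F L G \<le> 0\<close>.
\<close>

section \<open>Nonnegative matrices: lower bounds for the spectral radius\<close>

lemma index_mult_mat_sum:
  assumes "A \<in> carrier_mat n m" "B \<in> carrier_mat m l" "i < n" "j < l"
  shows "(A * B) $$ (i, j) = (\<Sum>k<m. A $$ (i, k) * B $$ (k, j))"
  using assms by (simp add: scalar_prod_def atLeast0LessThan)

lemma index_mult_mat_vec_sum:
  assumes "A \<in> carrier_mat n m" "v \<in> carrier_vec m" "i < n"
  shows "(A *\<^sub>v v) $ i = (\<Sum>k<m. A $$ (i, k) * v $ k)"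
  using assms by (simp add: scalar_prod_def atLeast0LessThan)

lemma pow_mat_nonneg:
  fixes D :: "real mat"
  assumes D: "D \<in> carrier_mat m m" and nonneg: "\<And>i j. i < m \<Longrightarrow> j < m \<Longrightarrow> 0 \<le> D $$ (i, j)"
  shows "i < m \<Longrightarrow> j < m \<Longrightarrow> 0 \<le> (D ^\<^sub>m k) $$ (i, j)"
proof (induction k arbitrary: j)
  case 0
  then show ?case using D by simp
next
  case (Suc k)
  then show ?case
    using D nonneg
    by (auto simp: index_mult_mat_sum[of _ m m _ m] simp del: index_mult_mat intro!: sum_nonneg)
qed

text \<open>Induction on \<open>k\<close>: since \<open>D ^\<^sub>m k\<close> is nonnegative,
  multiplying by it preserves the inequality \<open>r w \<le> D w\<close>, and
  \<open>r \<ge> 0\<close> lets the previous bound be scaled by \<open>r\<close>.\<close>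

lemma pow_mat_subinvariant:
  fixes D :: "real mat" and w :: "nat \<Rightarrow> real"
  assumes D: "D \<in> carrier_mat m m" and nonneg: "\<And>i j. i < m \<Longrightarrow> j < m \<Longrightarrow> 0 \<le> D $$ (i, j)"
    and r: "0 \<le> r" and sub: "\<And>i. i < m \<Longrightarrow> r * w i \<le> (\<Sum>j<m. D $$ (i, j) * w j)"
    and i: "i < m"
  shows "r ^ k * w i \<le> (\<Sum>j<m. (D ^\<^sub>m k) $$ (i, j) * w j)"
proof (induction k)
  case 0
  have "(\<Sum>j<m. (D ^\<^sub>m 0) $$ (i, j) * w j) = (\<Sum>j<m. if j = i then w j else 0)"
    using D i by (intro sum.cong) auto
  then show ?case using i by simp
next
  case (Suc k)
  let ?P = "D ^\<^sub>m k"
  have P: "?P \<in> carrier_mat m m" using D by simp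
  have "r ^ Suc k * w i = r * (r ^ k * w i)" by simp
  also have "\<dots> \<le> r * (\<Sum>j<m. ?P $$ (i, j) * w j)"
    using Suc r by (rule mult_left_mono)
  also have "\<dots> = (\<Sum>j<m. ?P $$ (i, j) * (r * w j))"
    by (simp add: sum_distrib_left mult_ac)
  also have "\<dots> \<le> (\<Sum>j<m. ?P $$ (i, j) * (\<Sum>l<m. D $$ (j, l) * w l))"
    using pow_mat_nonneg[OF D nonneg] i sub by (intro sum_mono mult_left_mono) auto
  also have "\<dots> = (\<Sum>l<m. (\<Sum>j<m. ?P $$ (i, j) * D $$ (j, l)) * w l)"
    unfolding sum_distrib_left sum_distrib_right by (subst sum.swap) (simp add: mult_ac)
  also have "\<dots> = (\<Sum>l<m. (D ^\<^sub>m Suc k) $$ (i, l) * w l)"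
    using i by (intro sum.cong) (simp_all add: index_mult_mat_sum[OF P D] del: index_mult_mat)
  finally show ?case .
qed

text \<open>The Collatz-Wielandt lower bound. If \<open>\<mu>\<close> exceeded the spectral radius,
  a rescaling of \<open>C\<close> would have bounded powers, while subinvariance of \<open>w\<close>
  would make these powers grow geometrically at \<open>i0\<close>.\<close>

lemma subinvariant_le_rho:
  fixes C :: "real mat" and w :: "nat \<Rightarrow> real"
  assumes C: "C \<in> carrier_mat m m" and nonneg: "\<And>i j. i < m \<Longrightarrow> j < m \<Longrightarrow> 0 \<le> C $$ (i, j)"
    and w: "\<And>i. i < m \<Longrightarrow> 0 \<le> w i" and i0: "i0 < m" "0 < w i0"
    and sub: "\<And>i. i < m \<Longrightarrow> \<mu> * w i \<le> (\<Sum>j<m. C $$ (i, j) * w j)"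
  shows "\<mu> \<le> rho C"
proof (rule ccontr)
  assume "\<not> \<mu> \<le> rho C"
  define cC where "cC = map_mat complex_of_real C"
  have cC: "cC \<in> carrier_mat m m" using C by (simp add: cC_def)
  have m: "0 < m" using i0 by simp
  have "0 \<le> rho C"
    using spectral_radius_mem_max(1)[OF cC m] by (auto simp: rho_def cC_def)
  \<comment> \<open>Any value strictly between \<open>rho C\<close> and \<open>\<mu>\<close> serves:
    \<open>C / t\<close> then has spectral radius below 1, while the growth factor
    \<open>\<mu> / t\<close> is above 1.\<close>
  define t where "t = (rho C + \<mu>) / 2"
  have t: "0 < t" "rho C < t" "t < \<mu>"
    using \<open>\<not> \<mu> \<le> rho C\<close> \<open>0 \<le> rho C\<close> by (auto simp: t_def)
  define D where "D = (1 / t) \<cdot>\<^sub>m C"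
  have D: "D \<in> carrier_mat m m" using C by (simp add: D_def)
  have Dnn: "\<And>i j. i < m \<Longrightarrow> j < m \<Longrightarrow> 0 \<le> D $$ (i, j)"
    using nonneg C t by (simp add: D_def)
  define cD where "cD = map_mat complex_of_real D"
  have cD: "cD \<in> carrier_mat m m" using D by (simp add: cD_def)
  have cCD: "cC = complex_of_real t \<cdot>\<^sub>m cD"
    using C t by (intro eq_matI) (auto simp: cC_def cD_def D_def)
  \<comment> \<open>An eigenvalue \<open>e\<close> of \<open>cD\<close> gives the eigenvalue
    \<open>t * e\<close> of \<open>cC\<close>, so \<open>t * norm e \<le> rho C < t\<close>.\<close>
  have "spectral_radius cD < 1"
  proof -
    obtain e where e: "e \<in> spectrum cD" "spectral_radius cD = norm e"
      using spectral_radius_mem_max(1)[OF cD m] by auto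
    then obtain v where v: "v \<in> carrier_vec m" "v \<noteq> 0\<^sub>v m" "cD *\<^sub>v v = e \<cdot>\<^sub>v v"
      using cD by (auto simp: spectrum_def eigenvalue_def eigenvector_def)
    have "cC *\<^sub>v v = of_real t \<cdot>\<^sub>v (cD *\<^sub>v v)"
      using v(1) cD by (intro eq_vecI) (auto simp: cCD)
    then have "cC *\<^sub>v v = (of_real t * e) \<cdot>\<^sub>v v"
      using v by (simp add: smult_smult_assoc)
    then have "of_real t * e \<in> spectrum cC"
      using v cC by (auto simp: spectrum_def eigenvalue_def eigenvector_def)
    then have "norm (of_real t * e) \<le> rho C"
      using spectral_radius_mem_max(2)[OF cC m] by (auto simp: rho_def cC_def)
    then have "t * norm e \<le> rho C" using t by (simp add: norm_mult)
    then have "t * norm e < t * 1" using t by linarith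
    then have "norm e < 1" using t(1) by (simp only: mult_less_cancel_left_pos)
    then show ?thesis using e by simp
  qed
  then obtain K where K: "\<And>k. norm_bound (cD ^\<^sub>m k) K"
    using spectral_radius_jnf_norm_bound_less_1_upper_triangular[OF cD] by blast
  have bound: "(D ^\<^sub>m k) $$ (i, j) \<le> K" if "i < m" "j < m" for i j k
  proof -
    have "cD ^\<^sub>m k = map_mat complex_of_real (D ^\<^sub>m k)"
      unfolding cD_def by (rule of_real_hom.mat_hom_pow[OF D, symmetric])
    then have "norm (complex_of_real ((D ^\<^sub>m k) $$ (i, j))) \<le> K"
      using K[of k] that D by (auto simp: norm_bound_def)
    then show ?thesis by simp
  qed
  define r where "r = \<mu> / t"
  have r: "1 < r" using t by (simp add: r_def)
  have Dsub: "r * w i \<le> (\<Sum>j<m. D $$ (i, j) * w j)" if "i < m" for i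
  proof -
    have "(\<Sum>j<m. D $$ (i, j) * w j) = (\<Sum>j<m. C $$ (i, j) * w j) / t"
      unfolding sum_divide_distrib using C that by (intro sum.cong) (auto simp: D_def)
    then show ?thesis using divide_right_mono[OF sub[OF that], of t] t by (simp add: r_def)
  qed
  have *: "r ^ k * w i0 \<le> K * (\<Sum>j<m. w j)" for k
  proof -
    have "r ^ k * w i0 \<le> (\<Sum>j<m. (D ^\<^sub>m k) $$ (i0, j) * w j)"
      using pow_mat_subinvariant[OF D Dnn _ Dsub i0(1)] r by simp
    also have "\<dots> \<le> (\<Sum>j<m. K * w j)"
      using bound i0 w by (intro sum_mono mult_right_mono) auto
    finally show ?thesis by (simp add: sum_distrib_left)
  qed
  obtain k where "K * (\<Sum>j<m. w j) / w i0 < r ^ k"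
    using real_arch_pow[OF r] by blast
  then show False using *[of k] i0 by (simp add: field_simps)
qed

text \<open>\<open>pick I\<close> enumerates \<open>I\<close> in increasing order. This allows sums
  over the indices of a submatrix to be reindexed as sums over \<open>I\<close>.\<close>

lemma bij_betw_pick:
  assumes "finite I"
  shows "bij_betw (pick I) {..<card I} I"
proof -
  have inj: "inj_on (pick I) {..<card I}"
    by (rule inj_onI) (metis lessThan_iff nat_neq_iff pick_mono_le)
  have "pick I ` {..<card I} \<subseteq> I" using pick_in_set_le by auto
  then have "pick I ` {..<card I} = I"
    using assms inj by (intro card_subset_eq) (auto simp: card_image)
  then show ?thesis using inj by (simp add: bij_betw_def)
qed

text \<open>Deleting row and column \<open>k\<close> removes only terms multiplied by
  \<open>w k = 0\<close>, so the remaining entries of \<open>w\<close> are subinvariant for a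
  principal submatrix of order \<open>n - 1\<close>, and its spectral radius is at most the maximum
  \<open>rho_sub B\<close>.\<close>

lemma subinvariant_le_rho_sub:
  fixes B :: "real mat" and w :: "nat \<Rightarrow> real"
  assumes B: "B \<in> carrier_mat n n" and nonneg: "\<And>i j. i < n \<Longrightarrow> j < n \<Longrightarrow> 0 \<le> B $$ (i, j)"
    and n: "2 \<le> n" and k: "k < n" "w k = 0"
    and w: "\<And>i. i < n \<Longrightarrow> 0 \<le> w i" and i0: "i0 < n" "0 < w i0"
    and sub: "\<And>i. i < n \<Longrightarrow> \<mu> * w i \<le> (\<Sum>j<n. B $$ (i, j) * w j)"
  shows "\<mu> \<le> rho_sub B"
proof -
  define I where "I = {..<n} - {k}"
  define C where "C = submatrix B I I"
  have fin: "finite I" and cI: "card I = n - 1" using k by (auto simp: I_def)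
  have I_eq: "{i. i < n \<and> i \<in> I} = I" by (auto simp: I_def)
  have C: "C \<in> carrier_mat (n - 1) (n - 1)"
    using B by (auto simp: C_def submatrix_def I_eq cI)
  have C_index: "C $$ (i, j) = B $$ (pick I i, pick I j)" if "i < n - 1" "j < n - 1" for i j
    using that B by (auto simp: C_def submatrix_def I_eq cI)
  have bij: "bij_betw (pick I) {..<n - 1} I" using bij_betw_pick[OF fin] cI by simp
  have pick_I: "pick I i \<in> I" if "i < n - 1" for i using bij that by (auto simp: bij_betw_def)
  have pick_n: "pick I i < n" if "i < n - 1" for i using pick_I[OF that] by (simp add: I_def)
  have "i0 \<in> I" using i0 k by (auto simp: I_def)
  then obtain i1 where i1: "i1 < n - 1" "pick I i1 = i0"
    using bij by (auto simp: bij_betw_def image_iff) (metis imageE lessThan_iff)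
  have "\<mu> \<le> rho C"
  proof (rule subinvariant_le_rho[OF C, where w = "\<lambda>i. w (pick I i)"])
    fix i assume i: "i < n - 1"
    have "\<mu> * w (pick I i) \<le> (\<Sum>j<n. B $$ (pick I i, j) * w j)"
      using sub pick_n[OF i] by simp
    also have "\<dots> = (\<Sum>j\<in>I. B $$ (pick I i, j) * w j)"
      using k by (intro sum.mono_neutral_right) (auto simp: I_def)
    also have "\<dots> = (\<Sum>j<n - 1. B $$ (pick I i, pick I j) * w (pick I j))"
      by (rule sum.reindex_bij_betw[OF bij, symmetric])
    also have "\<dots> = (\<Sum>j<n - 1. C $$ (i, j) * w (pick I j))"
      using C_index i by (intro sum.cong) auto
    finally show "\<mu> * w (pick I i) \<le> (\<Sum>j<n - 1. C $$ (i, j) * w (pick I j))" .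
  qed (use i1 i0 pick_n nonneg w in \<open>auto simp: C_index\<close>)
  also have "\<dots> \<le> rho_sub B"
    unfolding rho_sub_def
  proof (intro Max_ge imageI)
    have "principal_submatrices (dim_row B - 1) B \<subseteq> (\<lambda>I. submatrix B I I) ` Pow {..<n}"
      using B by (auto simp: principal_submatrices_def)
    then show "finite (rho ` principal_submatrices (dim_row B - 1) B)"
      by (meson finite_Pow_iff finite_imageI finite_lessThan finite_subset)
    \<comment> \<open>Here \<open>2 \<le> n\<close> makes the order \<open>n - 1\<close> positive,
      as \<open>principal_submatrices\<close> demands.\<close>
    show "C \<in> principal_submatrices (dim_row B - 1) B"
      using B n cI by (auto simp: principal_submatrices_def C_def I_def)
  qed
  finally show ?thesis .
qed

section \<open>N0-matrices: sign of the inverse and irreducibility\<close>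

lemma N0_matrix_splitting:
  assumes N0: "N0_matrix A" and A: "A \<in> carrier_mat n n"
  obtains s B where "2 \<le> n" "B \<in> carrier_mat n n"
    "\<And>i j. i < n \<Longrightarrow> j < n \<Longrightarrow> 0 \<le> B $$ (i, j)"
    "A = s \<cdot>\<^sub>m 1\<^sub>m n - B" "rho_sub B \<le> s" "s < rho B"
proof -
  have dim: "dim_row A = n" using A by simp
  from N0 obtain s B where "2 \<le> n" and B: "B \<in> carrier_mat n n" "0\<^sub>m n n \<le> B"
    and "A = s \<cdot>\<^sub>m 1\<^sub>m n - B" "rho_sub B \<le> s" "s < rho B"
    unfolding N0_matrix_def nonneg_splitting_def Let_def dim by blast
  moreover have "0 \<le> B $$ (i, j)" if "i < n" "j < n" for i j
    using B that by (auto simp: less_eq_mat_def)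
  ultimately show thesis using that by blast
qed

text \<open>For \<open>A = s I - B\<close> the inequality reads \<open>(s + e) w \<le> B w\<close>.
  As \<open>w\<close> has a zero entry, a nonzero \<open>w\<close> would give
  \<open>s + e \<le> rho_sub B \<le> s\<close>.\<close>

lemma N0_matrix_sub_semipositive:
  assumes N0: "N0_matrix A" and A: "A \<in> carrier_mat n n"
    and k: "k < n" "w k = 0" and w: "\<And>i. i < n \<Longrightarrow> 0 \<le> w i" and e: "0 < (e :: real)"
    and Aw: "\<And>i. i < n \<Longrightarrow> (\<Sum>j<n. A $$ (i, j) * w j) \<le> - e * w i"
    and i: "i < n"
  shows "w i = 0"
proof (rule ccontr)
  assume "w i \<noteq> 0"
  obtain s B where n: "2 \<le> n" and B: "B \<in> carrier_mat n n"
    and nn: "\<And>i j. i < n \<Longrightarrow> j < n \<Longrightarrow> 0 \<le> B $$ (i, j)"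
    and AB: "A = s \<cdot>\<^sub>m 1\<^sub>m n - B" and s: "rho_sub B \<le> s"
    using N0_matrix_splitting[OF N0 A] by metis
  have Bw: "(\<Sum>j<n. A $$ (i, j) * w j) = s * w i - (\<Sum>j<n. B $$ (i, j) * w j)" if "i < n" for i
  proof -
    have "(\<Sum>j<n. A $$ (i, j) * w j) = (\<Sum>j<n. (if j = i then s * w j else 0) - B $$ (i, j) * w j)"
      using that B by (intro sum.cong) (auto simp: AB algebra_simps)
    then show ?thesis using that by (simp add: sum_subtractf)
  qed
  have "(s + e) * w i \<le> (\<Sum>j<n. B $$ (i, j) * w j)" if "i < n" for i
    using Aw[OF that] Bw[OF that] by (simp add: distrib_right)
  then have "s + e \<le> rho_sub B"
    using subinvariant_le_rho_sub[where w = w and \<mu> = "s + e", OF B nn n k w i] w[OF i] \<open>w i \<noteq> 0\<close> by force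
  then show False using s e by simp
qed

text \<open>A substitute for the Perron vector. For an eigenvector \<open>v\<close> whose eigenvalue
  has modulus \<open>rho B\<close>, the triangle inequality gives \<open>rho B * u \<le> B u\<close>
  with \<open>u\<close> the moduli of \<open>v\<close>; hence \<open>e = rho B - s\<close> works. A
  zero entry of \<open>u\<close> would force \<open>v = 0\<close>.\<close>

lemma N0_matrix_positive_vector:
  assumes N0: "N0_matrix A" and A: "A \<in> carrier_mat n n"
  obtains u e where "0 < (e :: real)" "\<And>i. i < n \<Longrightarrow> 0 < u i"
    "\<And>i. i < n \<Longrightarrow> (\<Sum>j<n. A $$ (i, j) * u j) \<le> - e * u i"
proof -
  obtain s B where n: "2 \<le> n" and B: "B \<in> carrier_mat n n"
    and nn: "\<And>i j. i < n \<Longrightarrow> j < n \<Longrightarrow> 0 \<le> B $$ (i, j)"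
    and AB: "A = s \<cdot>\<^sub>m 1\<^sub>m n - B" and s: "s < rho B"
    using N0_matrix_splitting[OF N0 A] by metis
  define cB where "cB = map_mat complex_of_real B"
  have cB: "cB \<in> carrier_mat n n" using B by (simp add: cB_def)
  obtain l where l: "l \<in> spectrum cB" "rho B = norm l"
    using spectral_radius_mem_max(1)[OF cB] n by (auto simp: rho_def cB_def)
  then obtain v where v: "v \<in> carrier_vec n" "v \<noteq> 0\<^sub>v n" "cB *\<^sub>v v = l \<cdot>\<^sub>v v"
    using cB by (auto simp: spectrum_def eigenvalue_def eigenvector_def)
  define u where "u i = norm (v $ i)" for i
  define e where "e = rho B - s"
  have e: "0 < e" using s by (simp add: e_def)
  have Au: "(\<Sum>j<n. A $$ (i, j) * u j) \<le> - e * u i" if i: "i < n" for i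
  proof -
    have "(\<Sum>j<n. A $$ (i, j) * u j) = (\<Sum>j<n. (if j = i then s * u j else 0) - B $$ (i, j) * u j)"
      using i B by (intro sum.cong) (auto simp: AB algebra_simps)
    also have "\<dots> = s * u i - (\<Sum>j<n. B $$ (i, j) * u j)" using i by (simp add: sum_subtractf)
    finally have 1: "(\<Sum>j<n. A $$ (i, j) * u j) = s * u i - (\<Sum>j<n. B $$ (i, j) * u j)" .
    have "rho B * u i = norm ((cB *\<^sub>v v) $ i)"
      using v i l by (simp add: u_def norm_mult)
    also have "\<dots> = norm (\<Sum>j<n. cB $$ (i, j) * v $ j)"
      using index_mult_mat_vec_sum[OF cB v(1) i] by simp
    also have "\<dots> \<le> (\<Sum>j<n. norm (cB $$ (i, j) * v $ j))" by (rule norm_sum)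
    also have "\<dots> = (\<Sum>j<n. B $$ (i, j) * u j)"
      using B i nn by (intro sum.cong) (auto simp: cB_def u_def norm_mult)
    finally show ?thesis using 1 by (simp add: e_def algebra_simps)
  qed
  have "u k \<noteq> 0" if "k < n" for k
  proof
    assume "u k = 0"
    then have "u i = 0" if "i < n" for i
      using N0_matrix_sub_semipositive[OF N0 A \<open>k < n\<close> _ _ e Au that] by (simp add: u_def)
    then have "v = 0\<^sub>v n" using v(1) by (intro eq_vecI) (auto simp: u_def)
    then show False using v by simp
  qed
  then have "0 < u i" if "i < n" for i using that by (simp add: u_def)
  with e Au show thesis using that by blast
qed

lemma N0_matrix_inverse_nonpos:
  assumes N0: "N0_matrix A" and A: "A \<in> carrier_mat n n" and x: "x \<in> carrier_vec n"
    and Ax: "\<And>i. i < n \<Longrightarrow> 0 \<le> (A *\<^sub>v x) $ i" and i: "i < n"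
  shows "x $ i \<le> 0"
proof (rule ccontr)
  assume "\<not> x $ i \<le> 0"
  obtain u e where e: "0 < (e :: real)" and u: "\<And>i. i < n \<Longrightarrow> 0 < u i"
    and Au: "\<And>i. i < n \<Longrightarrow> (\<Sum>j<n. A $$ (i, j) * u j) \<le> - e * u i"
    using N0_matrix_positive_vector[OF N0 A] by metis
  \<comment> \<open>Only positive entries of \<open>x\<close> limit how far \<open>u - a x\<close>
    stays nonnegative. The minimal quotient \<open>a\<close> is the largest admissible scalar, and
    an index attaining it becomes a zero of \<open>w\<close>.\<close>
  define P where "P = {j. j < n \<and> 0 < x $ j}"
  define a where "a = Min ((\<lambda>j. u j / x $ j) ` P)"
  have P: "finite P" "P \<noteq> {}" using i \<open>\<not> x $ i \<le> 0\<close> by (auto simp: P_def)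
  then have "a \<in> (\<lambda>j. u j / x $ j) ` P" unfolding a_def by (intro Min_in) auto
  then obtain k where k: "k \<in> P" "a = u k / x $ k" by blast
  have a: "0 < a" using k u by (simp add: P_def)
  define w where "w j = u j - a * x $ j" for j
  have wk: "k < n" "w k = 0" using k by (auto simp: w_def P_def)
  have w: "0 \<le> w j" if j: "j < n" for j
  proof (cases "j \<in> P")
    case True
    then have "a \<le> u j / x $ j" using P by (simp add: a_def)
    then show ?thesis using True by (simp add: w_def P_def field_simps)
  next
    case False
    then have "a * x $ j \<le> 0" using j a by (simp add: P_def mult_le_0_iff)
    then show ?thesis using u[OF j] by (simp add: w_def)
  qed
  have Aw: "(\<Sum>j<n. A $$ (l, j) * w j) \<le> - e * u l" if l: "l < n" for l
  proof -
    have "(\<Sum>j<n. A $$ (l, j) * w j)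
        = (\<Sum>j<n. A $$ (l, j) * u j) - a * (\<Sum>j<n. A $$ (l, j) * x $ j)"
      by (simp add: w_def algebra_simps sum_subtractf sum_distrib_left)
    also have "\<dots> \<le> (\<Sum>j<n. A $$ (l, j) * u j)"
      using Ax[OF l] a by (simp add: index_mult_mat_vec_sum[OF A x l] del: index_mult_mat_vec)
    finally show ?thesis using Au[OF l] by simp
  qed
  \<comment> \<open>The bound on \<open>A w\<close> is in terms of \<open>u\<close>, but
    \<open>N0_matrix_sub_semipositive\<close> needs one in terms of \<open>w\<close>. This
    \<open>d\<close> satisfies \<open>d * w \<le> e * u\<close>; the summand 1 keeps the denominator
    positive where \<open>w\<close> vanishes.\<close>
  define d where "d = Min ((\<lambda>j. e * u j / (w j + 1)) ` {..<n})"
  have "d \<in> (\<lambda>j. e * u j / (w j + 1)) ` {..<n}" unfolding d_def using i by (intro Min_in) auto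
  then have d: "0 < d" using e u w by (auto intro!: divide_pos_pos add_nonneg_pos)
  have "d * w l \<le> e * u l" if l: "l < n" for l
  proof -
    have "d \<le> e * u l / (w l + 1)" using l by (auto simp: d_def)
    then have "d * (w l + 1) \<le> e * u l" using w[OF l] by (simp add: field_simps)
    then show ?thesis using d by (simp add: algebra_simps)
  qed
  then have "(\<Sum>j<n. A $$ (l, j) * w j) \<le> - d * w l" if "l < n" for l
    using Aw[OF that] that by force
  then have w0: "w l = 0" if "l < n" for l
    using N0_matrix_sub_semipositive[where w = w, OF N0 A wk w d _ that] by blast
  \<comment> \<open>Now \<open>w = 0\<close> contradicts \<open>A w \<le> - e u < 0\<close>.\<close>
  have "(\<Sum>j<n. A $$ (k, j) * w j) = 0" using w0 by simp
  moreover have "0 < e * u k" using e u[OF wk(1)] by (rule mult_pos_pos)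
  ultimately show False using Aw[OF wk(1)] by linarith
qed

text \<open>Let \<open>w\<close> agree with \<open>u\<close> on \<open>S\<close> and vanish
  elsewhere. Rows in \<open>S\<close> do not notice the cut because of the zero block; rows outside
  \<open>S\<close> meet only nonpositive off-diagonal entries. So \<open>w\<close> violates
  \<open>N0_matrix_sub_semipositive\<close>.\<close>

lemma N0_matrix_irreducible:
  assumes N0: "N0_matrix A" and A: "A \<in> carrier_mat n n"
    and S: "S \<subseteq> {..<n}" "S \<noteq> {}" "S \<noteq> {..<n}"
    and zero: "\<And>i j. i \<in> S \<Longrightarrow> j < n \<Longrightarrow> j \<notin> S \<Longrightarrow> A $$ (i, j) = 0"
  shows False
proof -
  obtain u e where e: "0 < (e :: real)" and u: "\<And>i. i < n \<Longrightarrow> 0 < u i"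
    and Au: "\<And>i. i < n \<Longrightarrow> (\<Sum>j<n. A $$ (i, j) * u j) \<le> - e * u i"
    using N0_matrix_positive_vector[OF N0 A] by metis
  define w where "w j = (if j \<in> S then u j else 0)" for j
  obtain k where k: "k < n" "k \<notin> S" using S by blast
  obtain i where i: "i \<in> S" "i < n" using S by blast
  have "(\<Sum>j<n. A $$ (l, j) * w j) \<le> - e * w l" if l: "l < n" for l
  proof (cases "l \<in> S")
    case True
    then have "(\<Sum>j<n. A $$ (l, j) * w j) = (\<Sum>j<n. A $$ (l, j) * u j)"
      using zero by (intro sum.cong) (auto simp: w_def)
    then show ?thesis using Au[OF l] True by (simp add: w_def)
  next
    case False
    have "A $$ (l, j) \<le> 0" if "j < n" "j \<noteq> l" for j
      using N0 A l that by (auto simp: N0_matrix_def Z_matrix_def)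
    then have "(\<Sum>j<n. A $$ (l, j) * w j) \<le> 0"
      using False u by (intro sum_nonpos) (auto simp: w_def mult_le_0_iff less_imp_le)
    then show ?thesis using False by (simp add: w_def)
  qed
  then have "w i = 0"
    using N0_matrix_sub_semipositive[OF N0 A k(1) _ _ e _ i(2), of w] k u
    by (simp add: w_def less_imp_le)
  then show False using i u by (simp add: w_def less_le)
qed

lemma N0_matrix_inverse:
  assumes N0: "N0_matrix A" and A: "A \<in> carrier_mat n n"
  obtains L where "L \<in> carrier_mat n n" "A * L = 1\<^sub>m n" "L * A = 1\<^sub>m n"
    "\<And>i j. i < n \<Longrightarrow> j < n \<Longrightarrow> L $$ (i, j) \<le> 0"
proof -
  have det: "det A \<noteq> 0"
  proof
    assume "det A = 0"
    then obtain v where v: "v \<in> carrier_vec n" "v \<noteq> 0\<^sub>v n" "A *\<^sub>v v = 0\<^sub>v n"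
      using det_0_iff_vec_prod_zero_field[OF A] by blast
    \<comment> \<open>Both \<open>v\<close> and \<open>- v\<close> have nonnegative image, so both
      are nonpositive.\<close>
    have "A *\<^sub>v (- v) = - (A *\<^sub>v v)"
      using v(1) A by (intro eq_vecI) auto
    then have v': "- v \<in> carrier_vec n" "A *\<^sub>v (- v) = 0\<^sub>v n"
      using v by auto
    have "v $ i = 0" if i: "i < n" for i
    proof (rule order_antisym)
      show "v $ i \<le> 0" using N0_matrix_inverse_nonpos[OF N0 A v(1) _ i] v by simp
      have "(- v) $ i \<le> 0" using N0_matrix_inverse_nonpos[OF N0 A v'(1) _ i] v' by simp
      then show "0 \<le> v $ i" using v i by simp
    qed
    then show False using v by (metis carrier_vecD eq_vecI index_zero_vec)
  qed
  define L where "L = (1 / det A) \<cdot>\<^sub>m adj_mat A"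
  have L: "L \<in> carrier_mat n n" using adj_mat(1)[OF A] by (simp add: L_def)
  have AL: "A * L = 1\<^sub>m n"
    using det adj_mat[OF A] A unfolding L_def
    by (subst mult_smult_distrib[OF A adj_mat(1)[OF A]]) (auto intro!: eq_matI)
  have "L $$ (i, j) \<le> 0" if i: "i < n" and j: "j < n" for i j
  proof -
    \<comment> \<open>Column \<open>j\<close> of \<open>L\<close> solves \<open>A x = e\<close> for
      a unit vector \<open>e \<ge> 0\<close>, so \<open>N0_matrix_inverse_nonpos\<close> gives its
      sign.\<close>
    have "A *\<^sub>v col L j = col (A * L) j" using A L j by (intro eq_vecI) auto
    then have "0 \<le> (A *\<^sub>v col L j) $ l" if "l < n" for l
      using that j by (simp add: AL)
    then have "col L j $ i \<le> 0"
      using N0_matrix_inverse_nonpos[OF N0 A _ _ i] L j by (metis carrier_matD(1) col_carrier_vec carrier_vecI dim_col)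
    then show ?thesis using L i j by simp
  qed
  then show thesis using that L AL mat_mult_left_right_inverse[OF A L AL] by blast
qed

section \<open>Group inverses from factorizations\<close>

text \<open>With \<open>V\<close> the inverse of \<open>G * F\<close> and \<open>L\<close> that of
  \<open>K\<close>, both products of the two matrices collapse to \<open>F * (V * G)\<close>; the
  other two identities follow by the same cancellations.\<close>

lemma is_group_inverse_of_factorization:
  fixes F G K :: "'a :: semiring_1 mat"
  assumes F: "F \<in> carrier_mat m r" and G: "G \<in> carrier_mat r m"
    and K: "K \<in> carrier_mat r r" and L: "L \<in> carrier_mat r r" and V: "V \<in> carrier_mat r r"
    and KL: "K * L = 1\<^sub>m r" and LK: "L * K = 1\<^sub>m r"
    and WV: "(G * F) * V = 1\<^sub>m r" and VW: "V * (G * F) = 1\<^sub>m r"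
  shows "is_group_inverse (F * (K * G)) (F * (V * (L * (V * G))))"
proof -
  note carr = F G K L V mult_carrier_mat[of _ r r _ m] mult_carrier_mat[of _ m r _ m]
    mult_carrier_mat[of _ r m _ m] mult_carrier_mat[of _ r m _ r] mult_carrier_mat[of _ r r _ r]
  note as = assoc_mult_mat[of _ m r _ m _ m] assoc_mult_mat[of _ r r _ m _ m]
  have GF: "G * F \<in> carrier_mat r r" using G F by simp
  \<comment> \<open>Once \<open>as\<close> nests all products to the right, these four rules cancel
    the inverse pairs in front of an arbitrary tail \<open>Z\<close>.\<close>
  have c1: "K * (L * Z) = Z" if "Z \<in> carrier_mat r m" for Z
    using that K L KL by (simp flip: assoc_mult_mat[of K r r L r Z m])
  have c2: "L * (K * Z) = Z" if "Z \<in> carrier_mat r m" for Z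
    using that K L LK by (simp flip: assoc_mult_mat[of L r r K r Z m])
  have c3: "V * (G * (F * Z)) = Z" if Z: "Z \<in> carrier_mat r m" for Z
  proof -
    have "(V * (G * F)) * Z = V * ((G * F) * Z)" by (rule assoc_mult_mat[OF V GF Z])
    also have "(G * F) * Z = G * (F * Z)" by (rule assoc_mult_mat[OF G F Z])
    finally show ?thesis using VW Z by simp
  qed
  have c4: "G * (F * (V * Z)) = Z" if Z: "Z \<in> carrier_mat r m" for Z
  proof -
    have "((G * F) * V) * Z = (G * F) * (V * Z)" by (rule assoc_mult_mat[OF GF V Z])
    also have "\<dots> = G * (F * (V * Z))" by (rule assoc_mult_mat[OF G F mult_carrier_mat[OF V Z]])
    finally show ?thesis using WV Z by simp
  qed
  have "F * (V * (L * (V * G))) \<in> carrier_mat m m"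
    using F G by (intro carrier_matI) auto
  then show ?thesis
    unfolding is_group_inverse_def by (simp add: carr carrier_matD[OF F] as c1 c2 c3 c4)
qed

lemma inverse_one_plus_scaled_idempotent:
  fixes P :: "'a :: field mat"
  assumes P: "P \<in> carrier_mat n n" and PP: "P * P = d \<cdot>\<^sub>m P" and d: "1 + d \<noteq> 0"
  obtains V where "V \<in> carrier_mat n n" "(1\<^sub>m n + P) * V = 1\<^sub>m n" "V * (1\<^sub>m n + P) = 1\<^sub>m n"
proof -
  \<comment> \<open>In \<open>(I + P) * (I - k P)\<close> the coefficient of \<open>P\<close> is
    \<open>1 - k - k * d\<close>, because \<open>P * P = d P\<close>; this \<open>k\<close> makes it
    vanish.\<close>
  define k where "k = 1 / (1 + d)"
  have k: "k + k * d = 1" using d by (simp add: k_def field_simps)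
  define V where "V = 1\<^sub>m n - k \<cdot>\<^sub>m P"
  have V: "V \<in> carrier_mat n n" using P by (auto simp: V_def)
  have W: "1\<^sub>m n + P \<in> carrier_mat n n" using P by auto
  have PV: "P * V = P - k \<cdot>\<^sub>m (d \<cdot>\<^sub>m P)"
    using P mult_minus_distrib_mat[OF P one_carrier_mat smult_carrier_mat[OF P]]
    by (simp add: V_def mult_smult_distrib[OF P P] PP)
  have "(1\<^sub>m n + P) * V = V + P * V"
    using P V by (simp add: add_mult_distrib_mat[of _ n n])
  also have "\<dots> = 1\<^sub>m n"
  proof (rule eq_matI)
    fix i j assume "i < dim_row (1\<^sub>m n :: 'a mat)" "j < dim_col (1\<^sub>m n :: 'a mat)"
    then have "(V + P * V) $$ (i, j) = 1\<^sub>m n $$ (i, j) + (1 - (k + k * d)) * P $$ (i, j)"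
      unfolding PV using P by (simp add: V_def algebra_simps)
    then show "(V + P * V) $$ (i, j) = 1\<^sub>m n $$ (i, j)" using k by simp
  qed (use P V in auto)
  finally have "(1\<^sub>m n + P) * V = 1\<^sub>m n" .
  then show thesis using that V mat_mult_left_right_inverse[OF W V] by blast
qed

section \<open>Bordered matrices and the Schur complement\<close>

text \<open>The blocks without columns, and those without rows in \<open>right_border\<close>, let
  \<open>four_block_mat\<close> express a mere juxtaposition, so that products follow from
  \<open>mult_four_block_mat\<close>.\<close>

definition left_border :: "'a :: {zero, one} mat \<Rightarrow> 'a mat" where
  "left_border Y = four_block_mat (1\<^sub>m (dim_col Y)) (0\<^sub>m (dim_col Y) 0) Y (0\<^sub>m (dim_row Y) 0)"

definition right_border :: "'a :: {zero, one} mat \<Rightarrow> 'a mat" where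
  "right_border X = four_block_mat (1\<^sub>m (dim_row X)) X (0\<^sub>m 0 (dim_row X)) (0\<^sub>m 0 (dim_col X))"

lemma border_carrier:
  "Y \<in> carrier_mat m n \<Longrightarrow> left_border Y \<in> carrier_mat (n + m) n"
  "X \<in> carrier_mat n m \<Longrightarrow> right_border X \<in> carrier_mat n (n + m)"
  by (auto simp: left_border_def right_border_def)

lemma right_border_mult_left_border:
  fixes X :: "'a :: ring_1 mat"
  assumes X: "X \<in> carrier_mat n m" and Y: "Y \<in> carrier_mat m n"
  shows "right_border X * left_border Y = 1\<^sub>m n + X * Y"
  using X Y unfolding left_border_def right_border_def
  by (subst mult_four_block_mat[of _ n n _ m _ 0 _ _ n _ 0]) (auto intro!: eq_matI)

text \<open>Serves twice: with \<open>K = A\<close> it factors \<open>M\<close>, and with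
  \<open>K = L\<close> it shows the blocks of the group inverse in the reducible case.\<close>

lemma left_border_mult_right_border:
  fixes X :: "'a :: ring_1 mat"
  assumes X: "X \<in> carrier_mat n m" and Y: "Y \<in> carrier_mat m n" and K: "K \<in> carrier_mat n n"
  shows "left_border Y * (K * right_border X) = four_block_mat K (K * X) (Y * K) (Y * (K * X))"
proof -
  have K': "K = four_block_mat K (0\<^sub>m n 0) (0\<^sub>m 0 n) (0\<^sub>m 0 0)"
    using K by (intro eq_matI) auto
  have KG: "K * right_border X = four_block_mat K (K * X) (0\<^sub>m 0 n) (0\<^sub>m 0 m)"
    using X K unfolding right_border_def
    by (subst K', subst mult_four_block_mat[of _ n n _ 0 _ 0 _ _ n _ m]) (auto intro!: eq_matI)
  show ?thesis
    unfolding KG unfolding left_border_def using X Y K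
    by (subst mult_four_block_mat[of _ n n _ 0 _ m _ _ n _ m]) (auto intro!: eq_matI)
qed

text \<open>Block elimination: \<open>?D\<close> is the Schur complement of \<open>A\<close>, so the
  determinant equals \<open>det A * det ?D\<close>, and the \<open>1 \<times> 1\<close> block
  \<open>?D\<close> must vanish.\<close>

lemma singular_border:
  fixes A :: "'a :: field mat"
  assumes A: "A \<in> carrier_mat n n" and X: "X \<in> carrier_mat n 1" and Y: "Y \<in> carrier_mat 1 n"
    and det: "det A \<noteq> 0" and sing: "det (four_block_mat A (A * X) (Y * A) (0\<^sub>m 1 1)) = 0"
  shows "Y * (A * X) = 0\<^sub>m 1 1"
proof -
  let ?D = "- (Y * (A * X))"
  let ?U = "four_block_mat (1\<^sub>m n) (0\<^sub>m n 1) Y (1\<^sub>m 1)"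
  let ?R = "four_block_mat A (A * X) (0\<^sub>m 1 n) ?D"
  have AX: "A * X \<in> carrier_mat n 1" using A X by simp
  have D: "?D \<in> carrier_mat 1 1" using Y AX by (metis mult_carrier_mat uminus_carrier_mat)
  have "?U * ?R = four_block_mat A (A * X) (Y * A) (0\<^sub>m 1 1)"
    using A X Y AX D by (subst mult_four_block_mat[of _ n n _ 1 _ 1 _ _ n _ 1]) (auto intro!: cong_four_block_mat eq_matI)
  moreover have "det (?U * ?R) = det ?U * det ?R"
    by (rule det_mult[OF four_block_carrier_mat[OF one_carrier_mat one_carrier_mat]
          four_block_carrier_mat[OF A D]])
  moreover have "det ?U = 1"
    using det_four_block_mat_upper_right_zero[OF one_carrier_mat refl Y one_carrier_mat] by simp
  moreover have "det ?R = det A * det ?D"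
    by (rule det_four_block_mat_lower_left_zero[OF A AX refl D])
  ultimately have "det ?D = 0" using sing det by simp
  then have "?D $$ (0, 0) = 0" using D by (simp add: det_single)
  then show ?thesis using Y AX by (intro eq_matI) auto
qed

section \<open>Reducibility in terms of index sets\<close>

lemma reducible_matE:
  assumes red: "reducible_mat M" and M: "M \<in> carrier_mat m m"
  obtains S where "S \<subseteq> {..<m}" "S \<noteq> {}" "S \<noteq> {..<m}"
    "\<And>i j. i \<in> S \<Longrightarrow> j < m \<Longrightarrow> j \<notin> S \<Longrightarrow> M $$ (i, j) = 0"
proof -
  have dim: "dim_row M = m" "dim_col M = m" using M by auto
  obtain p k l P Q R where p: "p permutes {..<m}" and k: "0 < k" and l: "0 < l"
    and P: "P \<in> carrier_mat k k" and R: "R \<in> carrier_mat l l"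
    and eq: "mat m m (\<lambda>(i, j). M $$ (p i, p j)) = four_block_mat P Q (0\<^sub>m l k) R"
    using red unfolding reducible_mat_def dim by blast
  have m: "m = k + l" using arg_cong[OF eq, of dim_row] P R by simp
  have zero: "M $$ (p i, p j) = 0" if "k \<le> i" "i < m" "j < k" for i j
    using arg_cong[OF eq, of "\<lambda>B. B $$ (i, j)"] that P R m by simp
  have inj: "inj p" and surj: "p ` {..<m} = {..<m}"
    using p by (auto simp: permutes_inj permutes_image)
  \<comment> \<open>The rows of the zero block are the last \<open>l\<close> indices, transported by
    \<open>p\<close>; its columns are the complement. \<open>l > 0\<close> makes \<open>S\<close>
    nonempty and \<open>k > 0\<close> makes it proper.\<close>
  define S where "S = p ` {k..<m}"
  show thesis
  proof (rule that[of S])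
    show "S \<subseteq> {..<m}" using surj by (auto simp: S_def)
    show "S \<noteq> {}" using m l by (simp add: S_def)
    have "p 0 \<in> {..<m}" using surj m k by auto
    moreover have "p 0 \<notin> S" using inj k by (auto simp: S_def inj_eq)
    ultimately show "S \<noteq> {..<m}" by auto
    fix i j assume i: "i \<in> S" and j: "j < m" "j \<notin> S"
    obtain i' where i': "i = p i'" "k \<le> i'" "i' < m" using i by (auto simp: S_def)
    have "j \<in> p ` {..<m}" using j surj by simp
    then obtain j' where j': "j = p j'" "j' < m" by auto
    then have "j' < k" using j by (force simp: S_def)
    then show "M $$ (i, j) = 0" using zero i' j' by simp
  qed
qed

section \<open>Rank, group inverse and signs for the singular bordered matrix\<close>

theorem theorem4p1:
  fixes n :: nat and M A :: "real mat" and b c :: "real vec"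
  assumes "A \<in> carrier_mat n n" and "b \<in> carrier_vec n" and "c \<in> carrier_vec n"
    and "M = four_block_mat A (mat_of_cols n [b]) (mat_of_rows n [c]) (0\<^sub>m 1 1)"
    and "F0_matrix M" and "det M = 0"
    and "N0_matrix A" and "b \<le> 0\<^sub>v n" and "c \<le> 0\<^sub>v n"
  shows "vec_space.rank (n + 1) M = n \<and>
    (\<exists>X. is_group_inverse M X) \<and>
    (reducible_mat M \<longrightarrow>
      group_inverse M \<le> 0\<^sub>m (n + 1) (n + 1) \<and> Z_matrix (group_inverse M))"
proof -
  note A = assms(1) and N0 = assms(7)
  have lt1: "(0::nat) < 1" by simp
  define bm where "bm = mat_of_cols n [b]"
  define cm where "cm = mat_of_rows n [c]"
  have bm: "bm \<in> carrier_mat n 1" and cm: "cm \<in> carrier_mat 1 n"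
    by (auto simp: bm_def cm_def)
  have bm_nonpos: "bm $$ (i, 0) \<le> 0" if "i < n" for i
    using that assms(8) by (simp add: bm_def less_eq_vec_def mat_of_cols_index)
  have cm_nonpos: "cm $$ (0, j) \<le> 0" if "j < n" for j
    using that assms(9) by (simp add: cm_def less_eq_vec_def mat_of_rows_index)
  have M_eq: "M = four_block_mat A bm cm (0\<^sub>m 1 1)"
    using assms(4) by (simp add: bm_def cm_def)
  have M: "M \<in> carrier_mat (n + 1) (n + 1)"
    unfolding M_eq by (rule four_block_carrier_mat[OF A zero_carrier_mat])
  obtain L where L: "L \<in> carrier_mat n n" and AL: "A * L = 1\<^sub>m n" and LA: "L * A = 1\<^sub>m n"
    and L_nonpos: "\<And>i j. i < n \<Longrightarrow> j < n \<Longrightarrow> L $$ (i, j) \<le> 0"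
    using N0_matrix_inverse[OF N0 A] by metis
  have "det A * det L = 1" using det_mult[OF A L] AL by simp
  then have detA: "det A \<noteq> 0" by auto
  define X where "X = L * bm"
  define Y where "Y = cm * L"
  have X: "X \<in> carrier_mat n 1" and Y: "Y \<in> carrier_mat 1 n"
    using L bm cm by (auto simp: X_def Y_def)
  have AX: "A * X = bm"
    using bm by (simp add: X_def AL flip: assoc_mult_mat[OF A L bm])
  have YA: "Y * A = cm"
    using cm by (simp add: Y_def LA assoc_mult_mat[OF cm L A])
  have X_nonneg: "0 \<le> X $$ (i, 0)" if "i < n" for i
    unfolding X_def index_mult_mat_sum[OF L bm that lt1]
    using L_nonpos bm_nonpos that by (intro sum_nonneg mult_nonpos_nonpos) auto
  have Y_nonneg: "0 \<le> Y $$ (0, j)" if "j < n" for j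
    unfolding Y_def index_mult_mat_sum[OF cm L lt1 that]
    using L_nonpos cm_nonpos that by (intro sum_nonneg mult_nonpos_nonpos) auto
  have YAX: "Y * (A * X) = 0\<^sub>m 1 1"
    using singular_border[OF A X Y detA] assms(6) by (simp add: AX YA M_eq)
  define F where "F = left_border Y"
  define G where "G = right_border X"
  have F: "F \<in> carrier_mat (n + 1) n" and G: "G \<in> carrier_mat n (n + 1)"
    unfolding F_def G_def using border_carrier(1)[OF Y] border_carrier(2)[OF X] by blast+
  \<comment> \<open>Singularity enters here: the corner \<open>Y * (A * X)\<close> of the product
    has to match the zero corner of \<open>M\<close>.\<close>
  have M_fac: "M = F * (A * G)"
    unfolding F_def G_def left_border_mult_right_border[OF X Y A]
    by (simp add: YAX) (simp add: AX YA M_eq)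
  have GF: "G * F = 1\<^sub>m n + X * Y"
    unfolding F_def G_def by (rule right_border_mult_left_border[OF X Y])
  \<comment> \<open>The inverse \<open>V\<close> of \<open>G * F\<close> is left open: existence in
    general needs some \<open>V\<close>, the reducible case takes the identity.\<close>
  note group_inv = is_group_inverse_of_factorization[OF F G A L _ AL LA, folded M_fac]

  \<comment> \<open>Singularity bounds the rank above; the nonzero leading minor
    \<open>det A\<close> bounds it below.\<close>
  have "vec_space.rank (n + 1) M = n"
  proof (rule order_antisym)
    show "vec_space.rank (n + 1) M \<le> n"
      using vec_space.det_zero_low_rank[OF M assms(6)] by simp
    have eq: "{i. i < n + 1 \<and> i \<in> {..<n}} = {..<n}" by auto
    have "pick {..<n} i = i" if "i < n" for i
      using pick_reduce_set[of i n UNIV] that by (simp add: pick_UNIV lessThan_def)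
    then have "submatrix M {..<n} {..<n} = A"
      using A M unfolding submatrix_def carrier_matD[OF M] eq
      by (intro eq_matI) (auto simp: M_eq)
    then show "n \<le> vec_space.rank (n + 1) M"
      using vec_space.rank_gt_minor[OF M, of "{..<n}" "{..<n}"] detA eq by simp
  qed
  moreover have "\<exists>Z. is_group_inverse M Z"
  proof -
    \<comment> \<open>\<open>Y * X\<close> is a scalar \<open>d\<close>, so \<open>X * Y\<close>
      squares to \<open>d\<close> times itself, and \<open>d \<ge> 0\<close> ensures
      \<open>1 + d \<noteq> 0\<close>.\<close>
    define d where "d = (Y * X) $$ (0, 0)"
    have "0 \<le> d"
      unfolding d_def index_mult_mat_sum[OF Y X lt1 lt1]
      using X_nonneg Y_nonneg by (intro sum_nonneg) auto
    have YX: "Y * X = d \<cdot>\<^sub>m 1\<^sub>m 1" using X Y by (intro eq_matI) (auto simp: d_def)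
    have XY: "X * Y \<in> carrier_mat n n" using X Y by simp
    have "(X * Y) * (X * Y) = X * ((Y * X) * Y)"
      using assoc_mult_mat[OF X Y XY] assoc_mult_mat[OF Y X Y] by simp
    also have "\<dots> = d \<cdot>\<^sub>m (X * Y)"
      using X Y by (simp add: YX mult_smult_assoc_mat[of _ 1 1] mult_smult_distrib[of _ n 1])
    finally obtain V where "V \<in> carrier_mat n n" "(G * F) * V = 1\<^sub>m n" "V * (G * F) = 1\<^sub>m n"
      using inverse_one_plus_scaled_idempotent[OF XY, of d] \<open>0 \<le> d\<close> by (auto simp: GF)
    then show ?thesis using group_inv by blast
  qed
  moreover have "group_inverse M \<le> 0\<^sub>m (n + 1) (n + 1) \<and> Z_matrix (group_inverse M)"
    if red: "reducible_mat M"
  proof -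
    obtain S where S: "S \<subseteq> {..<n + 1}" "S \<noteq> {}" "S \<noteq> {..<n + 1}"
      and zero: "\<And>i j. i \<in> S \<Longrightarrow> j < n + 1 \<Longrightarrow> j \<notin> S \<Longrightarrow> M $$ (i, j) = 0"
      using reducible_matE[OF red M] by metis
    have zeroA: "A $$ (i, j) = 0" if "i \<in> S - {n}" "j < n" "j \<notin> S - {n}" for i j
    proof -
      have "i < n" "i \<in> S" "j \<notin> S" using that S by force+
      then show ?thesis using zero[of i j] that A by (simp add: M_eq)
    qed
    \<comment> \<open>Index \<open>n\<close> belongs to the border; the rest of \<open>S\<close>
      would decompose \<open>A\<close> unless it is empty or everything.\<close>
    have "S - {n} = {} \<or> S - {n} = {..<n}"
    proof -
      have "S - {n} \<subseteq> {..<n}" using S by force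
      then show ?thesis using N0_matrix_irreducible[OF N0 A _ _ _ zeroA] by blast
    qed
    \<comment> \<open>If \<open>S = {n}\<close>, the last row of \<open>M\<close> vanishes, so
      \<open>Y = 0\<close>; if \<open>S = {..<n}\<close>, the last column vanishes, so
      \<open>X = 0\<close>.\<close>
    then have "X * Y = 0\<^sub>m n n"
    proof
      assume "S - {n} = {}"
      then have "S = {n}" using S by auto
      then have "cm $$ (0, j) = 0" if "j < n" for j
        using zero[of n j] that A by (simp add: M_eq)
      then have "cm = 0\<^sub>m 1 n" using cm by (intro eq_matI) auto
      then show ?thesis using X L by (simp add: Y_def)
    next
      assume *: "S - {n} = {..<n}"
      then have "n \<notin> S" using S by (auto simp: less_Suc_eq)
      then have "bm $$ (i, 0) = 0" if "i < n" for i
        using zero[of i n] that A * by (force simp: M_eq)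
      then have "bm = 0\<^sub>m n 1" using bm by (intro eq_matI) auto
      then show ?thesis using Y L by (simp add: X_def)
    qed
    then have "G * F = 1\<^sub>m n" by (simp add: GF)
    then have "is_group_inverse M (F * (1\<^sub>m n * (L * (1\<^sub>m n * G))))"
      by (intro group_inv) simp_all
    then have "is_group_inverse M (F * (L * G))"
      using G L by simp
    then have "group_inverse M = F * (L * G)"
      by (rule group_inverse_eq[rotated]) (simp add: carrier_matD[OF M])
    also have "\<dots> = four_block_mat L (L * X) (Y * L) (Y * (L * X))"
      unfolding F_def G_def by (rule left_border_mult_right_border[OF X Y L])
    finally have inv: "group_inverse M = four_block_mat L (L * X) (Y * L) (Y * (L * X))" .
    \<comment> \<open>Each block has exactly one factor \<open>L \<le> 0\<close>, its other factors
      \<open>X\<close> and \<open>Y\<close> being nonnegative.\<close>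
    have LX: "L * X \<in> carrier_mat n 1" using L X by simp
    have LX_nonpos: "(L * X) $$ (i, 0) \<le> 0" if "i < n" for i
      unfolding index_mult_mat_sum[OF L X that lt1]
      using L_nonpos X_nonneg that by (intro sum_nonpos mult_nonpos_nonneg) auto
    have YL_nonpos: "(Y * L) $$ (0, j) \<le> 0" if "j < n" for j
      unfolding index_mult_mat_sum[OF Y L lt1 that]
      using L_nonpos Y_nonneg that by (intro sum_nonpos mult_nonneg_nonpos) auto
    have YLX_nonpos: "(Y * (L * X)) $$ (0, 0) \<le> 0"
      unfolding index_mult_mat_sum[OF Y LX lt1 lt1]
      using LX_nonpos Y_nonneg by (intro sum_nonpos mult_nonneg_nonpos) auto
    have "group_inverse M \<le> 0\<^sub>m (n + 1) (n + 1)"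
      unfolding inv less_eq_mat_def using L X Y LX_nonpos YL_nonpos YLX_nonpos L_nonpos
      by (auto simp: less_Suc_eq simp del: index_mult_mat(1))
    then show ?thesis by (auto simp: Z_matrix_def less_eq_mat_def)
  qed
  ultimately show ?thesis by blast
qed

end
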